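(* Let $f\in\mathcal{G}$ have the power series expansion $f(z)=z+a_2z^2+a_3z^3+\cdots$ on the unit disk $\mathbb{D}$. Then \[ |H_3(1)| \le \frac{17}{1080}, \] where $H_3(1)=a_3(a_2a_4-a_3^2)-a_4(a_4-a_2a_3)+a_5(a_3-a_2^2)$ is the third order Hankel determinant of $f$.
   Context: Let $\mathbb{D}=\{z\in\mathbb{C}:|z|<1\}$ be the open unit disk. $\mathcal{A}$ denotes the class of functions $f$ analytic on $\mathbb{D}$ with expansion $f(z)=z+a_2z^2+a_3z^3+\cdots$ (i.e. $f(0)=0$, $f'(0)=1$). The class $\mathcal{G}$ is \[ \mathcal{G}=\left\{f\in\mathcal{A}:\ \operatorname{Re}\left[1+\frac{zf''(z)}{f'(z)}\right]<\frac32 \text{ for all } z\in\mathbb{D}\right\}, \] where the condition includes that $f'(z)\neq 0$ for all $z\in\mathbb{D}$, so that the quotient is defined. The third order Hankel determinant of $f\in\mathcal{A}$ is \[ H_3(1)=\begin{vmatrix} 1 & a_2 & a_3\\ a_2 & a_3 & a_4\\ a_3 & a_4 & a_5\end{vmatrix}. \] *)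

theory Defs
  imports "HOL-Complex_Analysis.Complex_Analysis"
begin

definition class_A :: "(complex \<Rightarrow> complex) set" where
  "class_A = {f. f holomorphic_on ball 0 1 \<and> f 0 = 0 \<and> deriv f 0 = 1}"

(* Division is total, so the condition that f' has no zeros must be stated explicitly. *)
definition class_G :: "(complex \<Rightarrow> complex) set" where
  "class_G = {f \<in> class_A. \<forall>z\<in>ball 0 1.
     deriv f z \<noteq> 0 \<and> Re (1 + z * deriv (deriv f) z / deriv f z) < 3 / 2}"

definition hankel3 :: "(nat \<Rightarrow> complex) \<Rightarrow> complex" where
  "hankel3 a = det (vector [vector [1, a 2, a 3],
                            vector [a 2, a 3, a 4],
                            vector [a 3, a 4, a 5]] :: complex ^ 3 ^ 3)"

lemma hankel3_expand:
  "hankel3 a = a 3 * (a 2 * a 4 - (a 3)\<^sup>2) - a 4 * (a 4 - a 2 * a 3) + a 5 * (a 3 - (a 2)\<^sup>2)"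
  by (simp add: hankel3_def det_3 vector_3 power2_eq_square algebra_simps)

end

theory Submission
  imports Defs
begin

text \<open>
  The condition \<open>Re (1 + z f'' / f') < 3/2\<close> says that \<open>\<omega> = z f'' / (z f'' - f')\<close> maps the disk
  into itself. Comparing coefficients in \<open>z f'' = \<omega> (z f'' - f')\<close> expresses
  \<open>8640 H\<^sub>3(1)\<close> as an integer polynomial in the first Taylor coefficients \<open>c\<^sub>1, \<dots>, c\<^sub>4\<close> of \<open>\<omega>\<close>.
  The integral mean of \<open>|\<omega>|\<^sup>2\<close> over circles gives \<open>|c\<^sub>1|\<^sup>2 + \<dots> + |c\<^sub>4|\<^sup>2 \<le> 1\<close>, and the bound
  then follows from the triangle inequality and AM-GM applied to each monomial.
\<close>

text \<open>Leaves \<open>$\<close> to mean only the coefficient of a formal power series.\<close>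

unbundle no vec_syntax

section \<open>Mean-square bound for Taylor coefficients\<close>

text \<open>On the circle of radius \<open>r\<close>, \<open>cnj u = r^2 / u\<close>. So this is
  Cauchy's formula for the \<open>k\<close>-th derivative at 0, written as an integral over the
  parameter and scaled by \<open>r ^ (2 * k)\<close>.\<close>

lemma has_integral_fps_nth_circlepath:
  assumes holo: "h holomorphic_on ball 0 1" and exp: "h has_fps_expansion H"
    and r: "0 < r" "r < 1"
  shows "((\<lambda>t. h (circlepath 0 r t) * cnj (circlepath 0 r t) ^ k) has_integral
           H $ k * of_real (r ^ (2 * k))) {0..1}"
proof -
  define c where "c = of_real (r ^ (2 * k)) / (2 * pi * \<i>)"
  have "((\<lambda>u. h u / (u - 0) ^ Suc k) has_contour_integral
          (2 * pi * \<i>) / fact k * (deriv ^^ k) h 0) (circlepath 0 r)"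
    using r by (intro Cauchy_has_contour_integral_higher_derivative_circlepath
        holomorphic_on_imp_continuous_on holomorphic_on_subset[OF holo]) auto
  then have "((\<lambda>t. c * (h (circlepath 0 r t) / circlepath 0 r t ^ Suc k *
      (2 * pi * \<i> * r * exp (2 * of_real pi * \<i> * t)))) has_integral
      c * ((2 * pi * \<i>) / fact k * (deriv ^^ k) h 0)) {0..1}"
    by (intro has_integral_mult_right)
      (simp add: has_contour_integral vector_derivative_circlepath)
  moreover have "c * ((2 * pi * \<i>) / fact k * (deriv ^^ k) h 0) = H $ k * of_real (r ^ (2 * k))"
  proof -
    have "c * (2 * pi * \<i>) = of_real (r ^ (2 * k))"
      by (simp add: c_def)
    then have "c * ((2 * pi * \<i>) / fact k * (deriv ^^ k) h 0)
        = of_real (r ^ (2 * k)) / fact k * (deriv ^^ k) h 0"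
      by (metis mult.assoc times_divide_eq_right)
    then show ?thesis
      by (simp add: fps_nth_fps_expansion[OF exp])
  qed
  \<comment> \<open>The velocity of the path is \<open>2 * pi * \<i> * u\<close>: it cancels one of
    the \<open>Suc k\<close> powers of \<open>u\<close> and the denominator of
    \<open>c\<close>.\<close>
  moreover have "c * (h (circlepath 0 r t) / circlepath 0 r t ^ Suc k *
      (2 * pi * \<i> * r * exp (2 * of_real pi * \<i> * t)))
      = h (circlepath 0 r t) * cnj (circlepath 0 r t) ^ k" for t
  proof -
    define u where "u = circlepath 0 r t"
    have u: "u = r * exp (2 * of_real pi * \<i> * t)"
      by (simp add: u_def circlepath)
    have "cmod u = r"
      using r by (simp add: u norm_mult)
    then have "u \<noteq> 0" and "u * cnj u = of_real (r ^ 2)"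
      using r complex_norm_square[of u] by auto
    then have "of_real (r ^ (2 * k)) = u ^ k * cnj u ^ k"
      by (metis of_real_power power_mult power_mult_distrib)
    then have "c * (h u / u ^ Suc k * (2 * pi * \<i> * u)) = h u * cnj u ^ k"
      using \<open>u \<noteq> 0\<close> by (simp add: c_def field_simps)
    then show ?thesis
      by (simp add: u_def[symmetric] u mult.assoc)
  qed
  ultimately show ?thesis
    by simp
qed

text \<open>Bessel's inequality. For the Taylor polynomial \<open>P\<close> of degree
  \<open>n\<close>, the mean of \<open>|h - P|^2 - |h|^2\<close> over a circle of radius
  \<open>r < 1\<close> is \<open>- S r\<close>, and the integrand is at least -1 because
  \<open>|h| \<le> 1\<close>. Then \<open>r\<close> tends to 1.\<close>

lemma sum_norm_fps_nth_le_one: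
  assumes holo: "h holomorphic_on ball 0 1" and exp: "h has_fps_expansion H"
    and bound: "\<And>z. z \<in> ball 0 1 \<Longrightarrow> cmod (h z) \<le> 1"
  shows "(\<Sum>k\<le>n. (cmod (H $ k))\<^sup>2) \<le> 1"
proof -
  define P where "P = (\<lambda>z. \<Sum>k\<le>n. H $ k * z ^ k)"
  define S where "S = (\<lambda>r. \<Sum>k\<le>n. (cmod (H $ k))\<^sup>2 * r ^ (2 * k))"
  have "S r \<le> 1" if r: "0 < r" "r < 1" for r
  proof -
    let ?u = "circlepath 0 r"
    \<comment> \<open>Pairing with \<open>P\<close> sees only the coefficients of \<open>g\<close>
      up to \<open>n\<close>, so \<open>g = P\<close> and \<open>g = h\<close> give the same
      value.\<close>
    have inner: "((\<lambda>t. g (?u t) * cnj (P (?u t))) has_integral of_real (S r)) {0..1}"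
      if "g holomorphic_on ball 0 1" "g has_fps_expansion G"
        and G: "\<And>k. k \<le> n \<Longrightarrow> G $ k = H $ k" for g G
    proof -
      have "((\<lambda>t. \<Sum>k\<le>n. cnj (H $ k) * (g (?u t) * cnj (?u t) ^ k)) has_integral
          (\<Sum>k\<le>n. cnj (H $ k) * (G $ k * of_real (r ^ (2 * k))))) {0..1}"
        using that r
        by (intro has_integral_sum has_integral_mult_right has_integral_fps_nth_circlepath) auto
      moreover have "(\<Sum>k\<le>n. cnj (H $ k) * (G $ k * of_real (r ^ (2 * k)))) = of_real (S r)"
        unfolding S_def of_real_sum of_real_mult complex_norm_square
        by (intro sum.cong) (auto simp: G)
      ultimately show ?thesis
        by (simp add: P_def sum_distrib_left mult_ac)
    qed
    have "P has_fps_expansion (\<Sum>k\<le>n. fps_const (H $ k) * fps_X ^ k)"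
      unfolding P_def by (intro fps_expansion_intros)
    moreover have "(\<Sum>k\<le>n. fps_const (H $ k) * fps_X ^ k) $ j = H $ j" if "j \<le> n" for j
      using that by (simp add: fps_sum_nth fps_X_power_nth if_distrib[of "(*) _"] cong: if_cong)
    moreover have "P holomorphic_on ball 0 1"
      unfolding P_def by (intro holomorphic_intros)
    ultimately have "((\<lambda>t. P (?u t) * cnj (P (?u t))) has_integral of_real (S r)) {0..1}"
      by (intro inner)
    moreover have "((\<lambda>t. h (?u t) * cnj (P (?u t))) has_integral of_real (S r)) {0..1}"
      using holo exp by (intro inner) auto
    ultimately have "((\<lambda>t. Re (P (?u t) * cnj (P (?u t)) - 2 * (h (?u t) * cnj (P (?u t)))))
        has_integral Re (of_real (S r) - 2 * of_real (S r))) {0..1}"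
      by (intro has_integral_Re has_integral_diff has_integral_mult_right)
    moreover have "((\<lambda>t. -1) has_integral (-1::real)) {0..1::real}"
      using has_integral_const_real[of "-1::real" 0 1] by simp
    moreover have "-1 \<le> Re (P z * cnj (P z) - 2 * (h z * cnj (P z)))"
      if "z \<in> ball 0 1" for z
    proof -
      \<comment> \<open>The right-hand side is \<open>|h - P|\<^sup>2 - |h|\<^sup>2\<close>.\<close>
      have "(Re (h z))\<^sup>2 + (Im (h z))\<^sup>2 \<le> 1"
        using bound[OF that] by (simp add: power_le_one flip: cmod_power2)
      moreover have "0 \<le> (Re (h z) - Re (P z))\<^sup>2 + (Im (h z) - Im (P z))\<^sup>2"
        by simp
      ultimately show ?thesis
        by (simp add: power2_eq_square algebra_simps)
    qed
    ultimately have "-1 \<le> Re (of_real (S r) - 2 * of_real (S r))"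
      using r by (elim has_integral_le[rotated]) (auto simp: circlepath norm_mult)
    then show ?thesis
      by simp
  qed
  then have "eventually (\<lambda>r. S r \<le> 1) (at_left 1)"
    using eventually_at_left_real[of 0 "1::real"] by (auto elim: eventually_mono)
  moreover have "(S \<longlongrightarrow> S 1) (at_left 1)"
    unfolding S_def by (intro tendsto_intros)
  ultimately have "S 1 \<le> 1"
    by (intro tendsto_upperbound) auto
  then show ?thesis
    by (simp add: S_def)
qed

section \<open>The Hankel determinant in Schwarz coefficients\<close>

lemma class_G_schwarz_coefficients:
  fixes F W :: "complex fps"
  assumes eq: "fps_X * fps_deriv (fps_deriv F) = W * (fps_X * fps_deriv (fps_deriv F) - fps_deriv F)"
    and F1: "F $ 1 = 1"
  shows "W $ 1 = - 2 * F $ 2"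
    and "W $ 2 = - 6 * F $ 3"
    and "W $ 3 = - 12 * F $ 4 - 6 * F $ 2 * F $ 3"
    and "W $ 4 = - 20 * F $ 5 - 18 * (F $ 3)\<^sup>2 - 16 * F $ 2 * F $ 4"
proof -
  define E where "E = fps_X * fps_deriv (fps_deriv F)"
  define D where "D = E - fps_deriv F"
  have E: "E $ n = of_nat n * of_nat (n + 1) * F $ (n + 1)" for n
    by (cases n) (auto simp: E_def mult_ac)
  have D: "D $ n = of_nat (n + 1) * (of_nat n - 1) * F $ (n + 1)" for n
    by (simp add: D_def E algebra_simps)
  \<comment> \<open>Since \<open>D $ 0 = -1\<close> and \<open>D $ 1 = 0\<close>, the equation for
    \<open>n\<close> can be solved for \<open>W $ n\<close>, and \<open>W $ (n - 1)\<close> drops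
    out of it when \<open>n > 0\<close>.\<close>
  have conv: "E $ n = (\<Sum>i=0..n. W $ i * D $ (n - i))" for n
    using eq unfolding D_def E_def fps_mult_nth[symmetric] by (rule arg_cong)
  have W0: "W $ 0 = 0"
    using conv[of 0] F1 by (simp add: E D)
  show W1: "W $ 1 = - 2 * F $ 2"
    using conv[of 1] F1 by (simp add: E D W0 numeral_2_eq_2)
  show W2: "W $ 2 = - 6 * F $ 3"
    using conv[of 2] F1 W0 by (simp add: E D numeral_eq_Suc)
  have "W $ 3 = 3 * W $ 1 * F $ 3 - 12 * F $ 4"
    using conv[of 3] F1 W0 by (simp add: E D numeral_eq_Suc)
  then show "W $ 3 = - 12 * F $ 4 - 6 * F $ 2 * F $ 3"
    by (simp add: W1[simplified])
  have "W $ 4 = 3 * W $ 2 * F $ 3 + 8 * W $ 1 * F $ 4 - 20 * F $ 5"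
    using conv[of 4] F1 W0 by (simp add: E D numeral_eq_Suc)
  then show "W $ 4 = - 20 * F $ 5 - 18 * (F $ 3)\<^sup>2 - 16 * F $ 2 * F $ 4"
    by (simp add: W1[simplified] W2 power2_eq_square)
qed

text \<open>After substitution this is a polynomial identity in \<open>a 2\<close>, ...,
  \<open>a 5\<close>. The factor 8640 is the least one that makes all coefficients on the right
  integers, since 3 and 76 are coprime.\<close>

lemma hankel3_schwarz_coefficients:
  assumes "c1 = - 2 * a 2" "c2 = - 6 * a 3" "c3 = - 12 * a 4 - 6 * a 2 * a 3"
    and "c4 = - 20 * a 5 - 18 * (a 3)\<^sup>2 - 16 * a 2 * a 4"
  shows "8640 * hankel3 a = 72 * c2 * c4 + 108 * c1 ^ 2 * c4 - 60 * c3 ^ 2 + 76 * c2 ^ 3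
    - 132 * c1 * c2 * c3 + 3 * c1 ^ 2 * c2 ^ 2 + 72 * c1 ^ 3 * c3 + 36 * c1 ^ 4 * c2"
  unfolding hankel3_expand assms
  by algebra

section \<open>Real inequalities for the polynomial\<close>

text \<open>On the unit sphere the product \<open>x * y * z\<close> is at most
  \<open>1 / (3 * sqrt 3)\<close>; 5 is a rational constant just below \<open>3 * sqrt 3\<close>.
  AM-GM on \<open>x * y\<close> reduces the claim to the two quantities \<open>s\<close> and
  \<open>z\<close>.\<close>

lemma mult3_le_sum_squares:
  fixes x y z :: real
  assumes "0 \<le> z" "x\<^sup>2 + y\<^sup>2 + z\<^sup>2 \<le> 1"
  shows "5 * (x * y * z) \<le> x\<^sup>2 + y\<^sup>2 + z\<^sup>2"
proof -
  define s where "s = x\<^sup>2 + y\<^sup>2"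
  have s: "0 \<le> s" "s \<le> 1 - z\<^sup>2"
    using assms by (auto simp: s_def)
  have "5 * (s * z) \<le> 2 * (s + z\<^sup>2)"
  proof (cases "5 * z \<le> 2")
    case True
    then show ?thesis
      using mult_left_mono[OF True s(1)] by (simp add: algebra_simps add_increasing2)
  next
    case False
    have "s * (5 * z - 2) \<le> (1 - z\<^sup>2) * (5 * z - 2)"
      using False s by (intro mult_right_mono) auto
    moreover have "z - z ^ 3 \<le> 2 / 5"
    proof -
      \<comment> \<open>The cubic lies above its tangent at 3/5, a rational point near the maximizer
        \<open>1 / sqrt 3\<close> of \<open>z - z ^ 3\<close>. This gives
        \<open>z - z ^ 3 \<le> 54 / 125 - 2 / 25 * z\<close>, which is below 2/5 exactly when
        \<open>z > 2 / 5\<close>, as in this case.\<close>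
      have "0 \<le> (z - 3 / 5)\<^sup>2 * (z + 6 / 5)"
        using assms by simp
      also have "(z - 3 / 5)\<^sup>2 * (z + 6 / 5) = z ^ 3 - 27 / 25 * z + 54 / 125"
        by (simp add: power2_eq_square power3_eq_cube field_simps)
      finally show ?thesis
        using False by linarith
    qed
    ultimately show ?thesis
      by (simp add: power2_eq_square power3_eq_cube algebra_simps)
  qed
  moreover have "2 * (x * y) * z \<le> s * z"
    using assms(1) sum_squares_bound[of x y] by (intro mult_right_mono) (auto simp: s_def)
  ultimately show ?thesis
    by (simp add: s_def)
qed

lemma schwarz_polynomial_le:
  fixes x y z w :: real
  assumes nonneg: "0 \<le> x" "0 \<le> y" "0 \<le> z" "0 \<le> w"
    and sum_le: "x\<^sup>2 + y\<^sup>2 + z\<^sup>2 + w\<^sup>2 \<le> 1"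
  shows "72 * y * w + 108 * x ^ 2 * w + 60 * z ^ 2 + 76 * y ^ 3 + 132 * x * y * z
    + 3 * x ^ 2 * y ^ 2 + 72 * x ^ 3 * z + 36 * x ^ 4 * y \<le> 136"
proof -
  have "x\<^sup>2 \<le> 1" "y\<^sup>2 \<le> 1"
    using sum_le by (smt (verit) zero_le_power2)+
  then have x1: "x \<le> 1" and y1: "y \<le> 1"
    using power2_le_imp_le[of _ "1::real"] by auto
  \<comment> \<open>The AM-GM weights here and below are uneven where an even split would push the
    total coefficient of some square above 136. Higher powers are first lowered using
    \<open>x \<le> 1\<close> and \<open>y \<le> 1\<close>.\<close>
  have "72 * y * w \<le> 18 * y\<^sup>2 + 72 * w\<^sup>2"
    using sum_squares_bound[of "y" "2 * w"] by (simp add: power_mult_distrib)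
  moreover have "x ^ 2 * w \<le> x * w"
    using x1 nonneg by (intro mult_right_mono) (auto simp: power2_eq_square mult_left_le)
  then have "108 * x ^ 2 * w \<le> 54 * x\<^sup>2 + 54 * w\<^sup>2"
    using sum_squares_bound[of x w] by simp
  moreover have "76 * y ^ 3 \<le> 76 * y\<^sup>2"
    using y1 nonneg by (simp add: power_decreasing)
  moreover have "x\<^sup>2 + y\<^sup>2 + z\<^sup>2 \<le> 1"
    using sum_le by (smt (verit) zero_le_power2)
  then have "5 * (132 * x * y * z) \<le> 132 * (x\<^sup>2 + y\<^sup>2 + z\<^sup>2)"
    using mult3_le_sum_squares[of z x y] nonneg by simp
  moreover have "x\<^sup>2 * y\<^sup>2 \<le> x * y"
    using x1 y1 nonneg by (intro mult_mono) (auto simp: power2_eq_square mult_left_le)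
  then have "3 * x ^ 2 * y ^ 2 \<le> 3 / 2 * x\<^sup>2 + 3 / 2 * y\<^sup>2"
    using sum_squares_bound[of x y] by simp
  moreover have "x ^ 3 * z \<le> x * z"
    using x1 nonneg power_decreasing[of 1 3 x] by (intro mult_right_mono) auto
  then have "72 * x ^ 3 * z \<le> 27 * x\<^sup>2 + 48 * z\<^sup>2"
    using sum_squares_bound[of "3 * x" "4 * z"] by (simp add: power_mult_distrib)
  moreover have "x ^ 4 * y \<le> x * y"
    using x1 nonneg power_decreasing[of 1 4 x] by (intro mult_right_mono) auto
  then have "36 * x ^ 4 * y \<le> 27 * x\<^sup>2 + 12 * y\<^sup>2"
    using sum_squares_bound[of "3 * x" "2 * y"] by (simp add: power_mult_distrib)
  \<comment> \<open>The total coefficients of the squares of \<open>x\<close>, \<open>y\<close>,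
    \<open>z\<close>, \<open>w\<close> are 135.9, 133.9, 134.4 and 126.\<close>
  ultimately show ?thesis
    using sum_le zero_le_power2[of x] zero_le_power2[of y] zero_le_power2[of z] zero_le_power2[of w]
    by argo
qed

lemma norm_schwarz_polynomial_le:
  fixes c1 c2 c3 c4 :: complex
  assumes "(cmod c1)\<^sup>2 + (cmod c2)\<^sup>2 + (cmod c3)\<^sup>2 + (cmod c4)\<^sup>2 \<le> 1"
  shows "cmod (72 * c2 * c4 + 108 * c1 ^ 2 * c4 - 60 * c3 ^ 2 + 76 * c2 ^ 3
    - 132 * c1 * c2 * c3 + 3 * c1 ^ 2 * c2 ^ 2 + 72 * c1 ^ 3 * c3 + 36 * c1 ^ 4 * c2) \<le> 136"
    (is "cmod ?p \<le> 136")
proof -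
  have "cmod ?p \<le> cmod (72 * c2 * c4) + cmod (108 * c1 ^ 2 * c4) + cmod (60 * c3 ^ 2)
    + cmod (76 * c2 ^ 3) + cmod (132 * c1 * c2 * c3) + cmod (3 * c1 ^ 2 * c2 ^ 2)
    + cmod (72 * c1 ^ 3 * c3) + cmod (36 * c1 ^ 4 * c2)"
    by (intro norm_triangle_mono norm_triangle_le_diff add_right_mono) simp_all
  then show ?thesis
    using schwarz_polynomial_le[OF _ _ _ _ assms] by (simp add: norm_mult norm_power)
qed

section \<open>From the half-plane condition to the bound\<close>

text \<open>The line \<open>Re q = 1 / 2\<close> is the perpendicular bisector of 0 and 1, so
  \<open>q = v / d\<close> is at least as close to 0 as to 1. Scaling by \<open>cmod d\<close> gives
  the claim.\<close>

lemma norm_le_norm_diff: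
  fixes v d :: complex
  assumes "d \<noteq> 0" "Re (v / d) \<le> 1 / 2"
  shows "cmod v \<le> cmod (v - d)"
proof -
  define q where "q = v / d"
  have "(cmod q)\<^sup>2 \<le> (cmod (q - 1))\<^sup>2"
    using assms(2) unfolding q_def[symmetric]
    by (simp only: cmod_power2) (simp add: power2_eq_square algebra_simps)
  then have "cmod q \<le> cmod (q - 1)"
    by (rule power2_le_imp_le) simp
  then have "cmod q * cmod d \<le> cmod (q - 1) * cmod d"
    by (rule mult_right_mono) simp
  then show ?thesis
    using assms(1) by (simp add: q_def left_diff_distrib flip: norm_mult)
qed

theorem theorem2:
  fixes f :: "complex \<Rightarrow> complex" and a :: "nat \<Rightarrow> complex"
  assumes "f \<in> class_G"
    and "\<And>z. z \<in> ball 0 1 \<Longrightarrow> (\<lambda>n. a n * z ^ n) sums f z"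
  shows "cmod (hankel3 a) \<le> 17 / 1080"
proof -
  define F where "F = Abs_fps a"
  have holo: "f holomorphic_on ball 0 1" and f': "deriv f 0 = 1"
    using assms(1) by (auto simp: class_G_def class_A_def)
  have df: "deriv f z \<noteq> 0"
    and re: "Re (z * deriv (deriv f) z / deriv f z) \<le> 1 / 2" if "z \<in> ball 0 1" for z
  proof -
    have "deriv f z \<noteq> 0 \<and> Re (1 + z * deriv (deriv f) z / deriv f z) < 3 / 2"
      using assms(1) that unfolding class_G_def by blast
    then show "deriv f z \<noteq> 0" and "Re (z * deriv (deriv f) z / deriv f z) \<le> 1 / 2"
      by simp_all
  qed
  have near_0: "eventually (\<lambda>z. z \<in> ball 0 1) (nhds (0::complex))"
    by (intro eventually_nhds_in_open) auto
  have F: "f has_fps_expansion F"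
    using assms(2) near_0
    by (intro has_fps_expansionI) (auto simp: F_def elim!: eventually_mono)
  define v where "v = (\<lambda>z. z * deriv (deriv f) z)"
  define \<omega> where "\<omega> = (\<lambda>z. v z / (v z - deriv f z))"
  have v: "v has_fps_expansion fps_X * fps_deriv (fps_deriv F)"
    unfolding v_def by (intro fps_expansion_intros F)
  \<comment> \<open>Equality would make the quotient \<open>v z / deriv f z\<close> equal to 1,
    whose real part exceeds 1/2.\<close>
  have ne: "v z - deriv f z \<noteq> 0" if "z \<in> ball 0 1" for z
    using df[OF that] re[OF that] by (auto simp: v_def)
  have holo_\<omega>: "\<omega> holomorphic_on ball 0 1"
    unfolding \<omega>_def v_def
    using ne holo by (intro holomorphic_intros holomorphic_deriv[of _ "ball 0 1"]) (auto simp: v_def)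
  have \<omega>_le: "cmod (\<omega> z) \<le> 1" if "z \<in> ball 0 1" for z
    using norm_le_norm_diff[of "deriv f z" "v z"] df[OF that] re[OF that] ne[OF that]
    by (simp add: \<omega>_def v_def norm_divide)
  define W where "W = fps_expansion \<omega> 0"
  have W: "\<omega> has_fps_expansion W"
    unfolding W_def using holo_\<omega> by (intro has_fps_expansion_fps_expansion) auto
  have "(\<lambda>z. \<omega> z * (v z - deriv f z)) has_fps_expansion
      W * (fps_X * fps_deriv (fps_deriv F) - fps_deriv F)"
    by (intro fps_expansion_intros W v F)
  \<comment> \<open>An identity near 0 suffices: expansions at 0 are unique, so it carries over to
    the formal series.\<close>
  moreover have "eventually (\<lambda>z. \<omega> z * (v z - deriv f z) = v z) (nhds 0)"
    using near_0 by eventually_elim (use ne in \<open>auto simp: \<omega>_def\<close>)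
  ultimately have "v has_fps_expansion W * (fps_X * fps_deriv (fps_deriv F) - fps_deriv F)"
    by (subst (asm) has_fps_expansion_cong) auto
  then have eq: "fps_X * fps_deriv (fps_deriv F) = W * (fps_X * fps_deriv (fps_deriv F) - fps_deriv F)"
    using v by (rule fps_expansion_unique_complex[rotated])
  have F1: "F $ 1 = 1"
    using fps_nth_fps_expansion[OF F, of 1] f' by simp
  have "(cmod (W $ 1))\<^sup>2 + (cmod (W $ 2))\<^sup>2 + (cmod (W $ 3))\<^sup>2 + (cmod (W $ 4))\<^sup>2
      \<le> (\<Sum>k\<le>4. (cmod (W $ k))\<^sup>2)"
    by (simp add: numeral_eq_Suc)
  also have "\<dots> \<le> 1"
    using holo_\<omega> W \<omega>_le by (rule sum_norm_fps_nth_le_one)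
  finally have le_1: "(cmod (W $ 1))\<^sup>2 + (cmod (W $ 2))\<^sup>2 + (cmod (W $ 3))\<^sup>2
      + (cmod (W $ 4))\<^sup>2 \<le> 1" .
  have coeffs: "W $ 1 = - 2 * a 2" "W $ 2 = - 6 * a 3" "W $ 3 = - 12 * a 4 - 6 * a 2 * a 3"
    "W $ 4 = - 20 * a 5 - 18 * (a 3)\<^sup>2 - 16 * a 2 * a 4"
    using class_G_schwarz_coefficients[OF eq F1] by (simp_all only: F_def fps_nth_Abs_fps)
  have "cmod (8640 * hankel3 a) \<le> 136"
    unfolding hankel3_schwarz_coefficients[OF coeffs]
    using le_1 by (rule norm_schwarz_polynomial_le)
  \<comment> \<open>\<open>136 / 8640 = 17 / 1080\<close>.\<close>
  then show ?thesis
    by (simp add: norm_mult)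
qed

end
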